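(* Let $a\in(1/15,\infty)$. Then the inequality $$\psi(x+1)>\mathcal{L}(x,a)$$ holds for all $x>0$ if and only if $a\in(1/15,a_0]$, where $a_0\approx 0.512967071402$ is the unique root of the equation (in $a$) $\psi(1)-\mathcal{L}(0,a)=0$ on $(1/15,\infty)$.
   Context: $\psi(x)=\Gamma'(x)/\Gamma(x)$ ($x>0$) is the digamma (psi) function. For $x\ge 0$ and $a>1/15$, $$\mathcal{L}(x,a)=\frac{1}{90a^{2}+2}\ln\left(x^{2}+x+\frac{3a+1}{3}\right)+\frac{45a^{2}}{90a^{2}+2}\ln\left(x^{2}+x+\frac{15a-1}{45a}\right).$$ *)

theory Defs
  imports "HOL-Analysis.Analysis"
begin

text \<open>
  For \<open>x \<ge> 0\<close> and \<open>a > 1/15\<close> both logarithms have positive arguments; outside this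
  range the value is an artefact of totality and is never used.
\<close>

definition L :: "real \<Rightarrow> real \<Rightarrow> real" where
  "L x a =
     1 / (90 * a^2 + 2) * ln (x^2 + x + (3 * a + 1) / 3) +
     45 * a^2 / (90 * a^2 + 2) * ln (x^2 + x + (15 * a - 1) / (45 * a))"

text \<open>
  The digamma function is the library's \<open>Digamma\<close>; that it equals \<open>Gamma' / Gamma\<close> on
  the positive reals is \<open>has_field_derivative_Gamma\<close>, restated here.
\<close>

lemma Digamma_eq_deriv_Gamma:
  assumes "x > (0::real)"
  shows "Digamma x = deriv Gamma x / Gamma x"
proof -
  have "x \<notin> \<int>\<^sub>\<le>\<^sub>0"
    using assms by (auto elim!: nonpos_Ints_cases)
  then have "(Gamma has_field_derivative Gamma x * Digamma x) (at x)"
    by (rule has_field_derivative_Gamma)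
  then have "deriv Gamma x = Gamma x * Digamma x"
    by (rule DERIV_imp_deriv)
  then show ?thesis
    using Gamma_real_pos[OF assms] by simp
qed

end

theory Submission
  imports Defs "HOL-Real_Asymp.Real_Asymp"
begin

text \<open>
  Write \<open>s = x\<^sup>2 + x + 1/3\<close>. Then \<open>L x a\<close> is half the mean of \<open>ln (s + X)\<close>, where \<open>X\<close> takes the two
  values \<open>a\<close> and \<open>- 1 / (45 a)\<close> with mean \<open>0\<close> and variance \<open>1/45\<close>; its third moment is \<open>c / 45\<close> with
  \<open>c = a - 1 / (45 a)\<close>. So \<open>a\<close> enters the derivative of \<open>L x a\<close> in \<open>x\<close>, a rational function, only
  through \<open>c\<close> (\<open>L_has_real_derivative\<close>). This derivative decreases in \<open>c\<close>, and \<open>L x a - ln x\<close>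
  tends to \<open>0\<close> for every \<open>a\<close>; hence \<open>L x a\<close> increases strictly in \<open>a\<close> (\<open>L_strict_mono\<close>). At
  \<open>x = 0\<close> this gives at most one root \<open>a0\<close>, and it reduces the inequality for all \<open>a \<le> a0\<close> to the one
  for \<open>a0\<close>. If \<open>a > a0\<close>, the inequality fails at \<open>x = 0\<close> and, by continuity, near it.

  For \<open>a0\<close> itself consider \<open>gap x = Digamma (x + 1) - L x a0\<close>, which tends to \<open>0\<close> along \<open>x + m\<close>. By
  the recurrence of the digamma function \<open>gap x - gap (x + 1)\<close> is elementary, and its derivative has a
  strikingly simple numerator (\<open>L_deriv_step\<close>): with \<open>z = x + 1\<close> it is
  \<open>(4 + 15 c)\<^sup>2 - 15 (16 - 21 c) z\<^sup>2\<close>. This changes sign at most once. Beyond the sign change the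
  difference decreases to \<open>0\<close>, so it is positive and the gap decreases along \<open>x + m\<close> to \<open>0\<close>; this
  proves the inequality for \<open>x \<ge> 1/6\<close> (\<open>L_less_Digamma_from\<close>). If instead \<open>c \<ge> 16/21\<close>, there is no sign
  change and the gap increases to \<open>0\<close> (\<open>gap_mono\<close>, \<open>Digamma_le_L\<close>).

  On \<open>(0, 1/6]\<close> the gap starts from the value \<open>0\<close>, so it is enough that it exceeds its value at the
  origin. One step of the recurrence followed by the monotonicity of the gap for the parameter \<open>4/5\<close>
  bounds its increase from below by that of an elementary function, whose derivative is estimated by
  hand (\<open>gap_0_less\<close>).

  The location of \<open>a0\<close> needs \<open>Digamma 1\<close> to fifteen digits. The comparisons above provide it:
  \<open>L 80 (3/4) < Digamma 81 \<le> L 80 (4/5)\<close>, both bounds being sharp to about \<open>10\<close> to the power \<open>-15\<close>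
  because \<open>3/4\<close> and \<open>4/5\<close> lie near the parameter with \<open>c = 16/21\<close>.
\<close>

section \<open>The function L and its parameter\<close>

definition skew :: "real \<Rightarrow> real" where
  "skew a = a - 1 / (45 * a)"

definition quad :: "real \<Rightarrow> real" where
  "quad x = x\<^sup>2 + x + 1/3"

text \<open>
  For \<open>c = skew a\<close> this is the product \<open>(s + a) (s - 1 / (45 a))\<close> of the arguments of the two
  logarithms, where \<open>s = quad x\<close>.
\<close>

definition den :: "real \<Rightarrow> real \<Rightarrow> real" where
  "den c x = (quad x)\<^sup>2 + c * quad x - 1/45"

text \<open>
  The derivative of \<open>L x a\<close> in \<open>x\<close>, with \<open>c\<close> in the place of \<open>skew a\<close>. The parameter \<open>c\<close> is kept free, so
  that a convenient rational number can be substituted for the skewness of an irrational \<open>a\<close>.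
\<close>

definition L_deriv :: "real \<Rightarrow> real \<Rightarrow> real" where
  "L_deriv c x = (2 * x + 1) * (quad x + c) / (2 * den c x)"

lemma quad_ge: "x \<ge> 0 \<Longrightarrow> quad x \<ge> 1/3"
  by (simp add: quad_def)

lemma skew_strict_mono:
  assumes "0 < a" "a < b"
  shows "skew a < skew b"
proof -
  have "1 / (45 * b) < 1 / (45 * a)"
    using assms by (simp add: field_simps)
  with assms show ?thesis by (simp add: skew_def)
qed

text \<open>
  At \<open>a = 1/15\<close> the second logarithm of \<open>L 0 a\<close> has argument \<open>0\<close>; correspondingly \<open>-4/15\<close> is the bound
  above which \<open>den\<close> stays positive on the nonnegative axis.
\<close>

lemma skew_gt:
  assumes "1/15 < a"
  shows "-4/15 < skew a"
  using skew_strict_mono[of "1/15" a] assms by (simp add: skew_def)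

lemma den_pos:
  assumes "-4/15 < c" "x \<ge> 0"
  shows "den c x > 0"
proof -
  have s: "quad x \<ge> 1/3" using assms(2) by (rule quad_ge)
  have "1/3 * (1/15) < quad x * (quad x + c)"
    using s assms(1) by (intro mult_le_less_imp_less) auto
  then show ?thesis by (simp add: den_def power2_eq_square algebra_simps)
qed

lemma quad_mono: "0 \<le> x \<Longrightarrow> x \<le> y \<Longrightarrow> quad x \<le> quad y"
  unfolding quad_def by (intro add_mono power_mono) auto

lemma den_mono:
  assumes "0 \<le> c" "0 \<le> x" "x \<le> y"
  shows "den c x \<le> den c y"
proof -
  have "0 \<le> quad x" using quad_ge[of x] assms by simp
  then show ?thesis
    unfolding den_def using assms quad_mono[of x y]
    by (intro diff_right_mono add_mono power_mono mult_left_mono) auto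
qed

text \<open>
  With \<open>v = 1 / (45 a)\<close> the weights of the logarithms are \<open>v / (2 (a + v))\<close> and \<open>a / (2 (a + v))\<close>. Adding
  the two simple fractions cancels the factor \<open>a + v\<close>, and only \<open>a - v\<close> and \<open>a v = 1/45\<close> survive.
\<close>

lemma L_has_real_derivative:
  assumes "1/15 < a" "x \<ge> 0"
  shows "((\<lambda>x. L x a) has_real_derivative L_deriv (skew a) x) (at x)"
proof -
  define v where "v = 1 / (45 * a)"
  have a: "a > 0" using assms by simp
  have v: "v > 0" "v < 1/3" "a * v = 1/45"
    using assms a by (auto simp: v_def field_simps)
  have s: "quad x \<ge> 1/3" using assms(2) by (rule quad_ge)
  have p: "quad x + a > 0" "quad x - v > 0" using s v a by auto
  have L_eq: "(\<lambda>x. L x a) = (\<lambda>x. v / (2 * (a + v)) * ln (quad x + a) + a / (2 * (a + v)) * ln (quad x - v))"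
  proof
    fix x
    have "1 / (90 * a^2 + 2) = v / (2 * (a + v))" "45 * a^2 / (90 * a^2 + 2) = a / (2 * (a + v))"
      using a by (auto simp: v_def field_simps power2_eq_square)
    moreover have "x^2 + x + (3 * a + 1) / 3 = quad x + a"
      "x^2 + x + (15 * a - 1) / (45 * a) = quad x - v"
      using a by (auto simp: quad_def v_def field_simps)
    ultimately show "L x a = v / (2 * (a + v)) * ln (quad x + a) + a / (2 * (a + v)) * ln (quad x - v)"
      by (simp add: L_def)
  qed
  have dq: "(quad has_real_derivative 2 * x + 1) (at x)"
    unfolding quad_def[abs_def] by (auto intro!: derivative_eq_intros)
  have den: "den (skew a) x = (quad x + a) * (quad x - v)"
    using v a by (simp add: den_def skew_def v_def power2_eq_square field_simps)
  have *: "v / (2 * (a + v)) * ((2 * x + 1) / (s + a)) + a / (2 * (a + v)) * ((2 * x + 1) / (s - v))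
      = (2 * x + 1) * (s + (a - v)) / (2 * ((s + a) * (s - v)))"
    if "s + a > 0" "s - v > 0" for s
  proof -
    have "a + v > 0" using a v by simp
    with that have "a + v \<noteq> 0" "s + a \<noteq> 0" "s - v \<noteq> 0" by auto
    then show ?thesis by (simp add: divide_simps) algebra
  qed
  have "((\<lambda>x. L x a) has_real_derivative
      v / (2 * (a + v)) * ((2 * x + 1) / (quad x + a)) + a / (2 * (a + v)) * ((2 * x + 1) / (quad x - v))) (at x)"
    unfolding L_eq using p
    by (intro DERIV_add DERIV_cmult) (auto intro!: derivative_eq_intros dq)
  moreover have "v / (2 * (a + v)) * ((2 * x + 1) / (quad x + a)) + a / (2 * (a + v)) * ((2 * x + 1) / (quad x - v))
      = L_deriv (skew a) x"
    unfolding *[OF p] L_deriv_def den by (simp add: skew_def v_def)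
  ultimately show ?thesis by simp
qed

text \<open>
  The two weights add up to \<open>1/2\<close>, and each logarithm is asymptotic to \<open>2 ln x\<close>.
\<close>

lemma L_minus_ln_tendsto_0:
  assumes "1/15 < a"
  shows "((\<lambda>x. L x a - ln x) \<longlongrightarrow> 0) at_top"
proof -
  have *: "((\<lambda>x. w * ln (x^2 + x + A) + (1/2 - w) * ln (x^2 + x + B) - ln x) \<longlongrightarrow> 0) at_top"
    for w A B :: real
    by real_asymp
  have "45 * a^2 / (90 * a^2 + 2) = 1/2 - 1 / (90 * a^2 + 2)"
  proof -
    have "90 * a^2 + 2 > 0" by (simp add: add_nonneg_pos)
    then show ?thesis by (simp add: field_simps)
  qed
  then show ?thesis unfolding L_def by (simp only: *)
qed

lemma L_deriv_diff:
  assumes "-4/15 < c" "-4/15 < c'" "x \<ge> 0"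
  shows "L_deriv c x - L_deriv c' x = (2 * x + 1) * (c' - c) / (90 * den c x * den c' x)"
proof -
  have "den c x \<noteq> 0" "den c' x \<noteq> 0"
    using den_pos assms by (metis less_irrefl)+
  then have "L_deriv c x - L_deriv c' x
      = (2 * x + 1) * ((quad x + c) * den c' x - (quad x + c') * den c x) / (2 * den c x * den c' x)"
    by (simp add: L_deriv_def divide_simps) algebra
  also have "(quad x + c) * den c' x - (quad x + c') * den c x = (c' - c) / 45"
    by (simp add: den_def) algebra
  finally show ?thesis by simp
qed

lemma L_deriv_strict_antimono:
  assumes "-4/15 < c" "c < c'" "x \<ge> 0"
  shows "L_deriv c' x < L_deriv c x"
proof -
  have "0 < (2 * x + 1) * (c' - c) / (90 * den c x * den c' x)"
    using assms by (intro divide_pos_pos mult_pos_pos den_pos) auto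
  then show ?thesis using L_deriv_diff[of c c' x] assms by simp
qed

text \<open>
  The difference of the values for \<open>b\<close> and \<open>a\<close> decreases in \<open>x\<close> and vanishes at infinity.
\<close>

lemma L_strict_mono:
  assumes "1/15 < a" "a < b" "x \<ge> 0"
  shows "L x a < L x b"
proof -
  have "0 < L x b - L x a"
  proof (rule DERIV_neg_imp_decreasing_at_top[where f = "\<lambda>x. L x b - L x a"])
    fix y assume "y \<ge> x"
    then have y: "y \<ge> 0" using assms by simp
    have "((\<lambda>x. L x b - L x a) has_real_derivative L_deriv (skew b) y - L_deriv (skew a) y) (at y)"
      using assms y by (intro DERIV_diff L_has_real_derivative) auto
    moreover have "L_deriv (skew b) y - L_deriv (skew a) y < 0"
      using L_deriv_strict_antimono[of "skew a" "skew b" y] skew_gt[of a] skew_strict_mono[of a b]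
        assms y by simp
    ultimately show "\<exists>d. ((\<lambda>x. L x b - L x a) has_real_derivative d) (at y) \<and> d < 0"
      by blast
  next
    have "((\<lambda>x. (L x b - ln x) - (L x a - ln x)) \<longlongrightarrow> 0 - 0) at_top"
      using assms by (intro tendsto_diff L_minus_ln_tendsto_0) auto
    then show "((\<lambda>x. L x b - L x a) \<longlongrightarrow> 0) at_top" by simp
  qed
  then show ?thesis by simp
qed

section \<open>Comparison with the digamma function by telescoping\<close>

text \<open>
  The derivative of \<open>gap a x - gap a (x + 1)\<close>. In the variable \<open>z = x + 1\<close> the expression is even, and the
  mean and variance built into \<open>L\<close> cancel all powers of \<open>z\<close> in the numerator above the second. The
  numbers \<open>16/21\<close> (below which the coefficient of \<open>z\<^sup>2\<close> is negative) and
  \<open>(4 + 15 c)\<^sup>2 / (15 (16 - 21 c))\<close> (the value of \<open>z\<^sup>2\<close> at the sign change) govern everything below.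
\<close>

lemma L_deriv_step:
  assumes "-4/15 < c" "x \<ge> 0"
  shows "L_deriv c (x + 1) - L_deriv c x + 1 / (x + 1)\<^sup>2
    = ((4 + 15 * c)\<^sup>2 - 15 * (16 - 21 * c) * (x + 1)\<^sup>2)
        / (2025 * (x + 1)\<^sup>2 * den c x * den c (x + 1))"
proof -
  have nz: "den c x \<noteq> 0" "den c (x + 1) \<noteq> 0" "x + 1 \<noteq> 0"
    using den_pos[of c x] den_pos[of c "x + 1"] assms by auto
  have reduce: "(2 * R / 2025) / (2 * w * p * q) = R / (2025 * w * p * q)" for R w p q :: real
    by simp
  define N where "N = (x + 1)\<^sup>2 * (2 * (x + 1) + 1) * (quad (x + 1) + c) * den c x
      - (x + 1)\<^sup>2 * (2 * x + 1) * (quad x + c) * den c (x + 1) + 2 * den c x * den c (x + 1)"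
  have key: "2025 * N
      = 2 * ((4 + 15 * c)\<^sup>2 - 15 * (16 - 21 * c) * (x + 1)\<^sup>2)"
    unfolding N_def den_def quad_def by algebra
  have "L_deriv c (x + 1) - L_deriv c x + 1 / (x + 1)\<^sup>2
    = N
      / (2 * (x + 1)\<^sup>2 * den c x * den c (x + 1))"
  proof -
    have *: "A / (2 * q) - B / (2 * p) + 1 / w = (w * A * p - w * B * q + 2 * p * q) / (2 * w * p * q)"
      if "p \<noteq> 0" "q \<noteq> 0" "w \<noteq> 0" for A B p q w :: real
      using that by (simp add: divide_simps) algebra
    have "(x + 1)\<^sup>2 \<noteq> 0" using nz by simp
    from *[OF nz(1,2) this] show ?thesis by (simp only: L_deriv_def N_def mult.assoc)
  qed
  also have "\<dots> = (2 * ((4 + 15 * c)\<^sup>2 - 15 * (16 - 21 * c) * (x + 1)\<^sup>2) / 2025)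
      / (2 * (x + 1)\<^sup>2 * den c x * den c (x + 1))"
    unfolding key[symmetric] by simp
  also have "\<dots> = ((4 + 15 * c)\<^sup>2 - 15 * (16 - 21 * c) * (x + 1)\<^sup>2)
        / (2025 * (x + 1)\<^sup>2 * den c x * den c (x + 1))"
    using reduce .
  finally show ?thesis .
qed

definition gap :: "real \<Rightarrow> real \<Rightarrow> real" where
  "gap a x = Digamma (x + 1) - L x a"

lemma gap_step:
  assumes "x \<ge> 0"
  shows "gap a x - gap a (x + 1) = L (x + 1) a - L x a - 1 / (x + 1)"
  using Digamma_plus1[of "x + 1"] assms by (simp add: gap_def)

text \<open>
  Both \<open>Digamma (x + 1 + m)\<close> and \<open>L (x + m) a\<close> differ from \<open>ln m\<close> by a null sequence.
\<close>

lemma gap_tendsto_0: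
  assumes "1/15 < a" "x \<ge> 0"
  shows "(\<lambda>m. gap a (x + real m)) \<longlonglongrightarrow> 0"
proof -
  have "(\<lambda>m. ln (real m) - (\<Sum>n<m. inverse (x + 1 + real n))) \<longlonglongrightarrow> Digamma (x + 1)"
    using Digamma_LIMSEQ[of "x + 1"] assms by simp
  from tendsto_diff[OF tendsto_const[of "Digamma (x + 1)"] this]
  have "(\<lambda>m. Digamma (x + 1) - (ln (real m) - (\<Sum>n<m. inverse (x + 1 + real n)))) \<longlonglongrightarrow> 0"
    by simp
  moreover have "Digamma (x + 1) - (ln (real m) - (\<Sum>n<m. inverse (x + 1 + real n)))
      = Digamma (x + 1 + real m) - ln (real m)" for m
    using Polygamma_plus_of_nat[of m "x + 1" 0] assms by (simp add: inverse_eq_divide)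
  ultimately have 1: "(\<lambda>m. Digamma (x + 1 + real m) - ln (real m)) \<longlonglongrightarrow> 0"
    by simp
  have "filterlim (\<lambda>m. x + real m) at_top sequentially"
    by real_asymp
  from filterlim_compose[OF L_minus_ln_tendsto_0[OF assms(1)] this]
  have 2: "(\<lambda>m. L (x + real m) a - ln (x + real m)) \<longlonglongrightarrow> 0" .
  have 3: "(\<lambda>m. ln (x + real m) - ln (real m)) \<longlonglongrightarrow> 0"
    by real_asymp
  from tendsto_diff[OF 1 tendsto_add[OF 2 3]] show ?thesis
    by (simp add: gap_def algebra_simps)
qed

lemma gap_step_tendsto_0:
  assumes "1/15 < a"
  shows "((\<lambda>x. L (x + 1) a - L x a - 1 / (x + 1)) \<longlongrightarrow> 0) at_top"
proof -
  have "filterlim (\<lambda>x::real. x + 1) at_top at_top"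
    by real_asymp
  from filterlim_compose[OF L_minus_ln_tendsto_0[OF assms(1)] this]
  have 1: "((\<lambda>x. L (x + 1) a - ln (x + 1)) \<longlongrightarrow> 0) at_top" .
  have 2: "((\<lambda>x::real. ln (x + 1) - ln x - 1 / (x + 1)) \<longlongrightarrow> 0) at_top"
    by real_asymp
  from tendsto_add[OF tendsto_diff[OF 1 L_minus_ln_tendsto_0[OF assms(1)]] 2] show ?thesis
    by (simp add: algebra_simps)
qed

lemma gap_step_has_real_derivative:
  assumes "1/15 < a" "x \<ge> 0"
  shows "((\<lambda>x. L (x + 1) a - L x a - 1 / (x + 1)) has_real_derivative
    ((4 + 15 * skew a)\<^sup>2 - 15 * (16 - 21 * skew a) * (x + 1)\<^sup>2)
        / (2025 * (x + 1)\<^sup>2 * den (skew a) x * den (skew a) (x + 1))) (at x)"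
proof -
  have "((\<lambda>x. L (x + 1) a) has_real_derivative L_deriv (skew a) (x + 1)) (at x)"
    using L_has_real_derivative[of a "x + 1"] assms by (simp add: DERIV_shift)
  moreover have "((\<lambda>x. 1 / (x + 1)) has_real_derivative - (1 / (x + 1)\<^sup>2)) (at x)"
    using assms by (auto intro!: derivative_eq_intros simp: power2_eq_square)
  ultimately have "((\<lambda>x. L (x + 1) a - L x a - 1 / (x + 1)) has_real_derivative
      L_deriv (skew a) (x + 1) - L_deriv (skew a) x - - (1 / (x + 1)\<^sup>2)) (at x)"
    using assms by (intro DERIV_diff L_has_real_derivative)
  then show ?thesis
    using L_deriv_step[of "skew a" x] skew_gt assms by simp
qed

lemma pos_if_strictly_decreasing_to_0:
  fixes f :: "nat \<Rightarrow> real"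
  assumes "\<And>m. f (Suc m) < f m" "f \<longlonglongrightarrow> 0"
  shows "0 < f 0"
proof -
  have "decseq f" using assms(1) by (intro decseq_SucI less_imp_le)
  then have "0 \<le> f 1" using assms(2) by (rule decseq_ge)
  also have "f 1 < f 0" using assms(1)[of 0] by simp
  finally show ?thesis .
qed

text \<open>
  The assumption \<open>turn\<close> places \<open>r\<close> beyond the sign change of \<open>L_deriv_step\<close>. From there on
  \<open>gap a y - gap a (y + 1)\<close> decreases to \<open>0\<close>, so it is positive; hence the gap decreases strictly along
  \<open>x + m\<close>, and its limit is \<open>0\<close>.
\<close>

lemma L_less_Digamma_from:
  assumes "1/15 < a" "r \<ge> 0"
    and turn: "(4 + 15 * skew a)\<^sup>2 < 15 * (16 - 21 * skew a) * (r + 1)\<^sup>2"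
    and "x \<ge> r"
  shows "L x a < Digamma (x + 1)"
proof -
  have dec: "gap a (y + 1) < gap a y" if "y \<ge> r" for y
  proof -
    have "0 < L (y + 1) a - L y a - 1 / (y + 1)"
    proof (rule DERIV_neg_imp_decreasing_at_top[where f = "\<lambda>x. L (x + 1) a - L x a - 1 / (x + 1)",
        OF _ gap_step_tendsto_0[OF assms(1)]])
      fix t assume "t \<ge> y"
      then have t: "t \<ge> r" "t \<ge> 0" using that assms by auto
      have "16 - 21 * skew a > 0"
      proof (rule ccontr)
        assume "\<not> 16 - 21 * skew a > 0"
        then have "15 * (16 - 21 * skew a) * (r + 1)\<^sup>2 \<le> 0"
          by (intro mult_nonpos_nonneg[OF mult_nonneg_nonpos]) simp_all
        with turn show False using zero_le_power2[of "4 + 15 * skew a"] by linarith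
      qed
      then have "15 * (16 - 21 * skew a) * (r + 1)\<^sup>2 \<le> 15 * (16 - 21 * skew a) * (t + 1)\<^sup>2"
        using t assms by (intro mult_left_mono power_mono) auto
      then have "(4 + 15 * skew a)\<^sup>2 - 15 * (16 - 21 * skew a) * (t + 1)\<^sup>2 < 0"
        using turn by linarith
      then have "((4 + 15 * skew a)\<^sup>2 - 15 * (16 - 21 * skew a) * (t + 1)\<^sup>2)
          / (2025 * (t + 1)\<^sup>2 * den (skew a) t * den (skew a) (t + 1)) < 0"
        using t assms den_pos skew_gt by (intro divide_neg_pos mult_pos_pos) auto
      then show "\<exists>d. ((\<lambda>x. L (x + 1) a - L x a - 1 / (x + 1)) has_real_derivative d) (at t) \<and> d < 0"
        using gap_step_has_real_derivative[OF assms(1) t(2)] by blast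
    qed
    then show ?thesis using gap_step[of y a] that assms by simp
  qed
  have "0 < gap a (x + real 0)"
  proof (rule pos_if_strictly_decreasing_to_0)
    show "gap a (x + real (Suc m)) < gap a (x + real m)" for m
      using dec[of "x + real m"] assms by (simp add: add_ac)
  qed (use assms in \<open>auto intro: gap_tendsto_0\<close>)
  then show ?thesis by (simp add: gap_def)
qed

lemma gap_step_strict_mono:
  assumes "1/15 < a" "16/21 \<le> skew a" "0 \<le> x" "x < y"
  shows "L (x + 1) a - L x a - 1 / (x + 1) < L (y + 1) a - L y a - 1 / (y + 1)"
proof (rule DERIV_pos_imp_increasing[where f = "\<lambda>x. L (x + 1) a - L x a - 1 / (x + 1)", OF assms(4)])
  fix t assume "x \<le> t" "t \<le> y"
  then have t: "t \<ge> 0" using assms by simp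
  have "15 * (16 - 21 * skew a) * (t + 1)\<^sup>2 \<le> 0"
    using assms by (intro mult_nonpos_nonneg[OF mult_nonneg_nonpos]) simp_all
  moreover have "(4 + 15 * skew a)\<^sup>2 > 0" using assms by simp
  ultimately have "(4 + 15 * skew a)\<^sup>2 - 15 * (16 - 21 * skew a) * (t + 1)\<^sup>2 > 0"
    by linarith
  then have "((4 + 15 * skew a)\<^sup>2 - 15 * (16 - 21 * skew a) * (t + 1)\<^sup>2)
      / (2025 * (t + 1)\<^sup>2 * den (skew a) t * den (skew a) (t + 1)) > 0"
    using t assms den_pos skew_gt by (intro divide_pos_pos mult_pos_pos) auto
  then show "\<exists>d. ((\<lambda>x. L (x + 1) a - L x a - 1 / (x + 1)) has_real_derivative d) (at t) \<and> d > 0"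
    using gap_step_has_real_derivative[OF assms(1) t] by blast
qed

text \<open>
  For \<open>x \<le> y\<close> the difference \<open>gap a (y + m) - gap a (x + m)\<close> decreases in \<open>m\<close>, by the preceding
  lemma, and tends to \<open>0\<close>. This compares increments of the digamma function with increments of \<open>L\<close>.
\<close>

lemma gap_mono:
  assumes "1/15 < a" "16/21 \<le> skew a" "0 \<le> x" "x \<le> y"
  shows "gap a x \<le> gap a y"
proof (cases "x = y")
  case False
  have "decseq (\<lambda>m. gap a (y + real m) - gap a (x + real m))"
  proof (rule decseq_SucI)
    fix m
    show "gap a (y + real (Suc m)) - gap a (x + real (Suc m)) \<le> gap a (y + real m) - gap a (x + real m)"
      using gap_step_strict_mono[OF assms(1,2), of "x + real m" "y + real m"]
        gap_step[of "x + real m" a] gap_step[of "y + real m" a] assms False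
      by (simp add: add_ac)
  qed
  moreover have "(\<lambda>m. gap a (y + real m) - gap a (x + real m)) \<longlonglongrightarrow> 0 - 0"
    using assms by (intro tendsto_diff gap_tendsto_0) auto
  ultimately have "gap a (y + real 0) - gap a (x + real 0) \<ge> 0"
    using decseq_ge by fastforce
  then show ?thesis by simp
qed simp

lemma Digamma_le_L:
  assumes "1/15 < a" "16/21 \<le> skew a" "0 \<le> x"
  shows "Digamma (x + 1) \<le> L x a"
proof -
  have "gap a x \<le> 0"
  proof (rule LIMSEQ_le_const[OF gap_tendsto_0[OF assms(1,3)]])
    show "\<exists>N. \<forall>n\<ge>N. gap a x \<le> gap a (x + real n)"
      using gap_mono[OF assms] by auto
  qed
  then show ?thesis by (simp add: gap_def)
qed

section \<open>The neighbourhood of the origin\<close>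

text \<open>
  Near the origin the sign of \<open>gap a x - gap a (x + 1)\<close> is of no use, because \<open>gap a 0\<close> may vanish. But
  \<open>gap a x = (Digamma (x + 2) - L (x + 1) (4/5)) + W x\<close> with an elementary \<open>W\<close>, and the bracket is
  nondecreasing by \<open>gap_mono\<close>, so it remains to show \<open>W 0 < W x\<close>. Up to a small correction the
  derivative of \<open>W\<close> is at least the fraction of \<open>L_deriv_step\<close> for \<open>c = 7/15\<close>: a numerator that is
  first positive and then negative over an increasing denominator, a multiple of \<open>E\<close>. Replacing
  \<open>E\<close> by its value at the sign change can only decrease such a quotient, on both sides of it. What
  remains is a quadratic polynomial, whose integral over \<open>[0, x]\<close> is positive as long as \<open>x \<le> 1/6\<close>.
\<close>

lemma gap_0_less:
  assumes "1/15 < a" "7/15 \<le> skew a" "0 < x" "x \<le> 1/6"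
  shows "gap a 0 < gap a x"
proof -
  define E where "E t = (t + 1)\<^sup>2 * den (7/15) t * den (7/15) (t + 1)" for t
  define \<kappa> where "\<kappa> = 93 / (2025 * E (1/8))"
  define W where "W t = L (t + 1) (4/5) - 1 / (t + 1) - L t a" for t
  define V where "V t = W t - \<kappa> * (17 * t / 64 - t\<^sup>2 - t ^ 3 / 3)" for t
  define W' where "W' t = L_deriv (139/180) (t + 1) + 1 / (t + 1)\<^sup>2 - L_deriv (skew a) t" for t

  have E_pos: "E t > 0" if "t \<ge> 0" for t
    unfolding E_def using that by (intro mult_pos_pos den_pos) auto
  have E_mono: "E t \<le> E u" if "0 \<le> t" "t \<le> u" for t u
    unfolding E_def using that den_pos[of "7/15" t] den_pos[of "7/15" u] den_pos[of "7/15" "t + 1"]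
    by (intro mult_mono power_mono den_mono mult_nonneg_nonneg) auto

  \<comment> \<open>The numerator is lowered to a multiple of \<open>81/64 - (t + 1)\<^sup>2\<close>, whose sign change at \<open>t = 1/8\<close> is rational.\<close>
  have W'_ge: "\<kappa> * (81/64 - (t + 1)\<^sup>2) \<le> W' t" if t: "0 \<le> t" "t \<le> 1/6" for t
  proof -
    define p q q' where "p = den (7/15) t" "q = den (7/15) (t + 1)" "q' = den (139/180) (t + 1)"
    have "den (139/180) 1 = 3901/540"
      by (simp add: den_def quad_def power2_eq_square)
    then have q': "7 \<le> q'" using den_mono[of "139/180" 1 "t + 1"] t by (simp add: p_q_q'_def)
    have "den (7/15) (1/6) \<le> 51/100"
      by (simp add: den_def quad_def power2_eq_square)
    then have p: "p \<le> 51/100" using den_mono[of "7/15" t "1/6"] t by (simp add: p_q_q'_def)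
    have pos: "p > 0" "q > 0" using t by (auto simp: p_q_q'_def intro: den_pos)
    have E_eq: "E t = (t + 1)\<^sup>2 * p * q" by (simp add: E_def p_q_q'_def)
    have "L_deriv (skew a) t \<le> L_deriv (7/15) t"
    proof (cases "skew a = 7/15")
      case True
      then show ?thesis by (simp only: order_refl)
    next
      case False
      then show ?thesis using L_deriv_strict_antimono[of "7/15" "skew a" t] assms t by simp
    qed
    \<comment> \<open>For \<open>c = 7/15\<close> the numerator in \<open>L_deriv_step\<close> is \<open>121 - 93 (t + 1)\<^sup>2\<close>; the other bracket is the correction.\<close>
    then have "W' t \<ge> (L_deriv (7/15) (t + 1) - L_deriv (7/15) t + 1 / (t + 1)\<^sup>2)
        - (L_deriv (7/15) (t + 1) - L_deriv (139/180) (t + 1))"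
      unfolding W'_def by linarith
    also have "L_deriv (7/15) (t + 1) - L_deriv (7/15) t + 1 / (t + 1)\<^sup>2 = (121 - 93 * (t + 1)\<^sup>2) / (2025 * E t)"
      using L_deriv_step[of "7/15" t] t by (simp add: E_def mult.assoc)
    also have "L_deriv (7/15) (t + 1) - L_deriv (139/180) (t + 1) = (2 * t + 3) * (11/36) / (90 * q * q')"
      using L_deriv_diff[of "7/15" "139/180" "t + 1"] t by (simp add: p_q_q'_def algebra_simps)
    also have "\<dots> = (2 * t + 3) * (55/8) * (t + 1)\<^sup>2 * p / q' / (2025 * E t)"
      using pos q' t by (simp add: E_eq field_simps)
    finally have W'_ge: "(121 - 93 * (t + 1)\<^sup>2) / (2025 * E t)
        - (2 * t + 3) * (55/8) * (t + 1)\<^sup>2 * p / q' / (2025 * E t) \<le> W' t" .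
    \<comment> \<open>The correction may use up \<open>211/64 = 121 - 93 * 81/64\<close>.\<close>
    have "(2 * t + 3) * (55/8) * (t + 1)\<^sup>2 * p / q'
        \<le> (2 * (1/6) + 3) * (55/8) * (1/6 + 1)\<^sup>2 * (51/100) / 7"
      using pos p q' t by (intro frac_le mult_mono power_mono) auto
    also have "\<dots> \<le> 211/64" by (simp add: power2_eq_square)
    finally have "(2 * t + 3) * (55/8) * (t + 1)\<^sup>2 * p / q' / (2025 * E t) \<le> 211/64 / (2025 * E t)"
      using E_pos[OF t(1)] by (intro divide_right_mono) auto
    with W'_ge have "(121 - 93 * (t + 1)\<^sup>2) / (2025 * E t) - 211/64 / (2025 * E t) \<le> W' t"
      by linarith
    moreover have "(121 - 93 * (t + 1)\<^sup>2) / (2025 * E t) - 211/64 / (2025 * E t)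
        = 93 / 2025 * ((81/64 - (t + 1)\<^sup>2) / E t)"
      using E_pos[OF t(1)] by (simp add: field_simps)
    ultimately have "93 / 2025 * ((81/64 - (t + 1)\<^sup>2) / E t) \<le> W' t" by simp
    \<comment> \<open>A nonnegative numerator meets a smaller denominator than \<open>E (1/8)\<close>, a nonpositive one a larger.\<close>
    moreover have "(81/64 - (t + 1)\<^sup>2) / E (1/8) \<le> (81/64 - (t + 1)\<^sup>2) / E t"
    proof (cases "t \<le> 1/8")
      case True
      have "(t + 1)\<^sup>2 \<le> (1/8 + 1)\<^sup>2" using True t by (intro power_mono) auto
      also have "\<dots> = 81/64" by (simp add: power2_eq_square)
      finally show ?thesis
        using E_mono[OF t(1) True] E_pos t by (intro divide_left_mono mult_pos_pos) auto
    next
      case False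
      have "81/64 = (1/8 + 1 :: real)\<^sup>2" by (simp add: power2_eq_square)
      also have "\<dots> \<le> (t + 1)\<^sup>2" using False by (intro power_mono) auto
      finally show ?thesis
        using E_mono[of "1/8" t] False E_pos t by (intro divide_left_mono_neg mult_pos_pos) auto
    qed
    moreover have \<kappa>_eq: "\<kappa> * (81/64 - (t + 1)\<^sup>2) = 93 / 2025 * ((81/64 - (t + 1)\<^sup>2) / E (1/8))"
      by (simp add: \<kappa>_def)
    ultimately show ?thesis unfolding \<kappa>_eq by linarith
  qed

  have W_deriv: "(W has_real_derivative W' t) (at t)" if "0 \<le> t" for t
  proof -
    have "((\<lambda>t. L (t + 1) (4/5)) has_real_derivative L_deriv (skew (4/5)) (t + 1)) (at t)"
      using L_has_real_derivative[of "4/5" "t + 1"] that by (simp add: DERIV_shift)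
    moreover have "((\<lambda>t. 1 / (t + 1)) has_real_derivative - (1 / (t + 1)\<^sup>2)) (at t)"
      using that by (auto intro!: derivative_eq_intros simp: power2_eq_square)
    ultimately have "(W has_real_derivative
        L_deriv (skew (4/5)) (t + 1) - - (1 / (t + 1)\<^sup>2) - L_deriv (skew a) t) (at t)"
      unfolding W_def[abs_def] using assms that by (intro DERIV_diff L_has_real_derivative)
    moreover have "skew (4/5) = 139/180" by (simp add: skew_def)
    ultimately show ?thesis by (simp add: W'_def)
  qed
  have "V 0 \<le> V x"
  proof (rule DERIV_nonneg_imp_nondecreasing[where f = V])
    fix t assume t: "0 \<le> t" "t \<le> x"
    have "(V has_real_derivative W' t - \<kappa> * (17/64 - 2 * t - t\<^sup>2)) (at t)"
      unfolding V_def[abs_def] using t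
      by (auto intro!: derivative_eq_intros W_deriv simp: power2_eq_square)
    moreover have "17/64 - 2 * t - t\<^sup>2 = 81/64 - (t + 1)\<^sup>2"
      by (simp add: power2_eq_square algebra_simps)
    ultimately show "\<exists>d. (V has_real_derivative d) (at t) \<and> 0 \<le> d"
      using W'_ge[of t] t assms by auto
  qed (use assms in auto)
  moreover have "0 < \<kappa> * (17 * x / 64 - x\<^sup>2 - x ^ 3 / 3)"
  proof (rule mult_pos_pos)
    show "\<kappa> > 0" using E_pos[of "1/8"] by (simp add: \<kappa>_def)
    have "x * x \<le> x * (1/6)" "x * x * x \<le> x * x * (1/6)"
      using assms by (auto intro!: mult_left_mono)
    then show "0 < 17 * x / 64 - x\<^sup>2 - x ^ 3 / 3"
      unfolding power2_eq_square power3_eq_cube using assms by linarith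
  qed
  ultimately have "W 0 < W x" by (simp add: V_def)
  moreover have "gap (4/5) 1 \<le> gap (4/5) (x + 1)"
    using assms by (intro gap_mono) (auto simp: skew_def)
  ultimately show ?thesis
    using gap_step[of x a] gap_step[of 0 a] assms
      Digamma_plus1[of "x + 1"] Digamma_plus1[of "1::real"]
    by (simp add: gap_def W_def)
qed

section \<open>Numerical enclosures\<close>

text \<open>
  The parameter \<open>y\<close> is the argument of the series of the inverse hyperbolic tangent for \<open>ln x\<close>. The
  numbers \<open>x\<close> below are close to \<open>1\<close>, so that at most six terms of it are needed.
\<close>

lemma ln_enclosure:
  fixes x y lo hi :: real and n :: nat
  defines "approx \<equiv> \<Sum>k<n. 2 * y ^ (2 * k + 1) / real (2 * k + 1)"
  assumes "x > 1" "y = (x - 1) / (x + 1)"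
    and "lo \<le> approx" "approx + 2 * (y ^ (2 * n + 1) / (1 - y\<^sup>2) / real (2 * n + 1)) \<le> hi"
  shows "ln x \<in> {lo..hi}"
  using ln_approx_bounds[OF assms(2), of n] assms by auto

lemma ln_16_15: "ln (16/15 :: real) \<in> {0.06453852113757117165 .. 0.06453852113757117170}"
  by (rule ln_enclosure[where y = "1/31" and n = 6]) (simp_all add: lessThan_nat_numeral power_divide)

lemma ln_25_24: "ln (25/24 :: real) \<in> {0.04082199452025512953 .. 0.04082199452025512958}"
  by (rule ln_enclosure[where y = "1/49" and n = 6]) (simp_all add: lessThan_nat_numeral power_divide)

lemma ln_81_80: "ln (81/80 :: real) \<in> {0.01242251999855715329 .. 0.01242251999855715334}"
  by (rule ln_enclosure[where y = "1/161" and n = 4]) (simp_all add: lessThan_nat_numeral power_divide)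

text \<open>
  The quotients \<open>16/15\<close>, \<open>25/24\<close> and \<open>81/80\<close> of numbers without prime factors above \<open>5\<close> are close to \<open>1\<close>,
  and the three relations determine the logarithms of \<open>2\<close>, \<open>3\<close> and \<open>5\<close>.
\<close>

lemma ln_2_3_5_relations:
  "ln (16/15 :: real) = 4 * ln 2 - ln 3 - ln 5"
  "ln (25/24 :: real) = 2 * ln 5 - 3 * ln 2 - ln 3"
  "ln (81/80 :: real) = 4 * ln 3 - 4 * ln 2 - ln 5"
proof -
  have "ln (2 ^ 4 / (3 * 5) :: real) = 4 * ln 2 - ln 3 - ln 5"
    "ln (5 ^ 2 / (2 ^ 3 * 3) :: real) = 2 * ln 5 - 3 * ln 2 - ln 3"
    "ln (3 ^ 4 / (2 ^ 4 * 5) :: real) = 4 * ln 3 - 4 * ln 2 - ln 5"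
    by (simp_all only: ln_div ln_mult ln_realpow zero_less_numeral zero_less_power mult_pos_pos) simp_all
  then show "ln (16/15 :: real) = 4 * ln 2 - ln 3 - ln 5"
    "ln (25/24 :: real) = 2 * ln 5 - 3 * ln 2 - ln 3"
    "ln (81/80 :: real) = 4 * ln 3 - 4 * ln 2 - ln 5"
    by simp_all
qed

lemma ln_2_enclosure: "ln (2 :: real) \<in> {0.693147180559945308 .. 0.693147180559945311}"
  using ln_16_15 ln_25_24 ln_81_80 unfolding ln_2_3_5_relations by simp

lemma ln_3_enclosure: "ln (3 :: real) \<in> {1.098612288668109690 .. 1.098612288668109693}"
  using ln_16_15 ln_25_24 ln_81_80 unfolding ln_2_3_5_relations by simp

lemma ln_5_enclosure: "ln (5 :: real) \<in> {1.609437912434100373 .. 1.609437912434100376}"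
  using ln_16_15 ln_25_24 ln_81_80 unfolding ln_2_3_5_relations by simp

text \<open>
  Enclosures of the first and the second logarithm in \<open>L 80 (4/5)\<close> (suffix \<open>upper\<close>) and in
  \<open>L 80 (3/4)\<close> (suffix \<open>lower\<close>). Their arguments differ little from \<open>80 * 81 = 6480\<close>, which has only the
  prime factors \<open>2\<close>, \<open>3\<close> and \<open>5\<close>; this is the reason for the choice of \<open>80\<close>.
\<close>

lemma ln_fst_80_upper: "ln (97217/15 :: real) \<in> {8.77665067117294382 .. 8.77665067117294387}"
proof -
  have "ln (97217/97200 :: real) \<in> {0.00017488182662346235 .. 0.00017488182662346240}"
    by (rule ln_enclosure[where y = "17/194417" and n = 2]) (simp_all add: lessThan_nat_numeral power_divide)
  moreover have "ln (2 ^ 4 * 3 ^ 4 * 5 * (97217/97200) :: real) = 4 * ln 2 + 4 * ln 3 + ln 5 + ln (97217/97200)"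
    by (simp only: ln_div ln_mult ln_realpow zero_less_numeral zero_less_power mult_pos_pos divide_pos_pos) simp
  then have "ln (97217/15 :: real) = 4 * ln 2 + 4 * ln 3 + ln 5 + ln (97217/97200)"
    by simp
  ultimately show ?thesis
    using ln_2_enclosure ln_3_enclosure ln_5_enclosure by simp
qed

lemma ln_snd_80_upper: "ln (233291/36 :: real) \<in> {8.77652294186973925 .. 8.77652294186973930}"
proof -
  have "ln (233291/233280 :: real) \<in> {0.00004715252341889262 .. 0.00004715252341889267}"
    by (rule ln_enclosure[where y = "11/466571" and n = 2]) (simp_all add: lessThan_nat_numeral power_divide)
  moreover have "ln (2 ^ 4 * 3 ^ 4 * 5 * (233291/233280) :: real) = 4 * ln 2 + 4 * ln 3 + ln 5 + ln (233291/233280)"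
    by (simp only: ln_div ln_mult ln_realpow zero_less_numeral zero_less_power mult_pos_pos divide_pos_pos) simp
  then have "ln (233291/36 :: real) = 4 * ln 2 + 4 * ln 3 + ln 5 + ln (233291/233280)"
    by simp
  ultimately show ?thesis
    using ln_2_enclosure ln_3_enclosure ln_5_enclosure by simp
qed

lemma ln_fst_80_lower: "ln (77773/12 :: real) \<in> {8.77664295644308147 .. 8.77664295644308152}"
proof -
  have "ln (77773/77760 :: real) \<in> {0.00016716709676111916 .. 0.00016716709676111921}"
    by (rule ln_enclosure[where y = "13/155533" and n = 2]) (simp_all add: lessThan_nat_numeral power_divide)
  moreover have "ln (2 ^ 4 * 3 ^ 4 * 5 * (77773/77760) :: real) = 4 * ln 2 + 4 * ln 3 + ln 5 + ln (77773/77760)"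
    by (simp only: ln_div ln_mult ln_realpow zero_less_numeral zero_less_power mult_pos_pos divide_pos_pos) simp
  then have "ln (77773/12 :: real) = 4 * ln 2 + 4 * ln 3 + ln 5 + ln (77773/77760)"
    by simp
  ultimately show ?thesis
    using ln_2_enclosure ln_3_enclosure ln_5_enclosure by simp
qed

lemma ln_snd_80_lower: "ln (874841/135 :: real) \<in> {8.77652265610356656 .. 8.77652265610356661}"
proof -
  have "ln (874841/874800 :: real) \<in> {0.00004686675724620612 .. 0.00004686675724620617}"
    by (rule ln_enclosure[where y = "41/1749641" and n = 2]) (simp_all add: lessThan_nat_numeral power_divide)
  moreover have "ln (2 ^ 4 * 3 ^ 4 * 5 * (874841/874800) :: real) = 4 * ln 2 + 4 * ln 3 + ln 5 + ln (874841/874800)"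
    by (simp only: ln_div ln_mult ln_realpow zero_less_numeral zero_less_power mult_pos_pos divide_pos_pos) simp
  then have "ln (874841/135 :: real) = 4 * ln 2 + 4 * ln 3 + ln 5 + ln (874841/874800)"
    by simp
  ultimately show ?thesis
    using ln_2_enclosure ln_3_enclosure ln_5_enclosure by simp
qed

text \<open>
  The same for \<open>L 0 a\<close>, where \<open>a\<close> is the upper end (suffix \<open>hi\<close>) or the lower end (suffix \<open>lo\<close>) of the
  interval of length \<open>10\<close> to the power \<open>-12\<close> around \<open>0.512967071402\<close>. The arguments are close to \<open>27/32\<close>
  in the first logarithm and to \<open>125/432\<close> in the second.
\<close>

lemma ln_fst_0_hi: "ln (1015560485683/1200000000000 :: real) \<in> {- 0.16688089406462983 .. - 0.16688089406462978}"
proof -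
  have "ln (1015560485683/1012500000000 :: real) \<in> {0.00301814273076766391 .. 0.00301814273076766396}"
    by (rule ln_enclosure[where y = "3060485683/2028060485683" and n = 3]) (simp_all add: lessThan_nat_numeral power_divide)
  moreover have "ln (3 ^ 3 / 2 ^ 5 * (1015560485683/1012500000000) :: real) = 3 * ln 3 - 5 * ln 2 + ln (1015560485683/1012500000000)"
    by (simp only: ln_div ln_mult ln_realpow zero_less_numeral zero_less_power mult_pos_pos divide_pos_pos) simp
  then have "ln (1015560485683/1200000000000 :: real) = 3 * ln 3 - 5 * ln 2 + ln (1015560485683/1012500000000)"
    by simp
  ultimately show ?thesis
    using ln_2_enclosure ln_3_enclosure ln_5_enclosure by simp
qed

lemma ln_fst_0_lo: "ln (5077802428409/6000000000000 :: real) \<in> {- 0.16688089406581145 .. - 0.16688089406581140}"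
proof -
  have "ln (5077802428409/5062500000000 :: real) \<in> {0.00301814272958605039 .. 0.00301814272958605044}"
    by (rule ln_enclosure[where y = "15302428409/10140302428409" and n = 3]) (simp_all add: lessThan_nat_numeral power_divide)
  moreover have "ln (3 ^ 3 / 2 ^ 5 * (5077802428409/5062500000000) :: real) = 3 * ln 3 - 5 * ln 2 + ln (5077802428409/5062500000000)"
    by (simp only: ln_div ln_mult ln_realpow zero_less_numeral zero_less_power mult_pos_pos divide_pos_pos) simp
  then have "ln (5077802428409/6000000000000 :: real) = 3 * ln 3 - 5 * ln 2 + ln (5077802428409/5062500000000)"
    by simp
  ultimately show ?thesis
    using ln_2_enclosure ln_3_enclosure ln_5_enclosure by simp
qed

lemma ln_snd_0_hi: "ln (535560485683/1846681457049 :: real) \<in> {- 1.23783166497524386 .. - 1.23783166497524381}"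
proof -
  have "ln (25706903312784/25648353570125 :: real) \<in> {0.00228018596656535743 .. 0.00228018596656535748}"
    by (rule ln_enclosure[where y = "58549742659/51355256882909" and n = 3]) (simp_all add: lessThan_nat_numeral power_divide)
  moreover have "ln (5 ^ 3 / (2 ^ 4 * 3 ^ 3) * (25706903312784/25648353570125) :: real) = 3 * ln 5 - 4 * ln 2 - 3 * ln 3 + ln (25706903312784/25648353570125)"
    by (simp only: ln_div ln_mult ln_realpow zero_less_numeral zero_less_power mult_pos_pos divide_pos_pos) simp
  then have "ln (535560485683/1846681457049 :: real) = 3 * ln 5 - 4 * ln 2 - 3 * ln 3 + ln (25706903312784/25648353570125)"
    by simp
  ultimately show ?thesis
    using ln_2_enclosure ln_3_enclosure ln_5_enclosure by simp
qed

lemma ln_snd_0_lo: "ln (2677802428409/9233407285227 :: real) \<in> {- 1.23783166497553506 .. - 1.23783166497553501}"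
proof -
  have "ln (42844838854544/42747255950125 :: real) \<in> {0.00228018596627415703 .. 0.00228018596627415708}"
    by (rule ln_enclosure[where y = "97582904419/85592094804669" and n = 3]) (simp_all add: lessThan_nat_numeral power_divide)
  moreover have "ln (5 ^ 3 / (2 ^ 4 * 3 ^ 3) * (42844838854544/42747255950125) :: real) = 3 * ln 5 - 4 * ln 2 - 3 * ln 3 + ln (42844838854544/42747255950125)"
    by (simp only: ln_div ln_mult ln_realpow zero_less_numeral zero_less_power mult_pos_pos divide_pos_pos) simp
  then have "ln (2677802428409/9233407285227 :: real) = 3 * ln 5 - 4 * ln 2 - 3 * ln 3 + ln (42844838854544/42747255950125)"
    by simp
  ultimately show ?thesis
    using ln_2_enclosure ln_3_enclosure ln_5_enclosure by simp
qed

lemma harm_80: "harm 80 = (4880292608058024066886120358155997 / 982844219842241906412811281988800 :: real)"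
  by (simp add: harm_expand)

lemma Digamma_1_eq: "Digamma 1 = Digamma (80 + 1 :: real) - harm 80"
  by (simp add: Digamma_numeral)

text \<open>
  The skewness of \<open>4/5\<close> exceeds \<open>16/21\<close> by about \<open>0.01\<close> only, so \<open>L 80 (4/5)\<close> overestimates
  \<open>Digamma 81\<close> by less than \<open>2\<close> units of the sixteenth decimal. This accuracy is needed:
  \<open>L 0 a - Digamma 1\<close> at the upper end of the interval for \<open>a\<close> is about \<open>11\<close> of these units.
\<close>

lemma Digamma_1_less: "Digamma (1 :: real) < - 0.5772156649015327"
proof -
  have "Digamma (80 + 1 :: real) \<le> L 80 (4/5)"
    by (intro Digamma_le_L) (auto simp: skew_def)
  also have "L 80 (4/5) = 5/298 * ln (97217/15) + 144/298 * ln (233291/36)"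
    by (simp add: L_def power2_eq_square)
  finally show ?thesis
    using ln_fst_80_upper ln_snd_80_upper unfolding Digamma_1_eq harm_80 by simp
qed

text \<open>
  The skewness of \<open>3/4\<close> is below \<open>16/21\<close>, and \<open>x = 80\<close> lies beyond the sign change. At the lower end of the
  interval for \<open>a\<close> the margin is about \<open>300\<close> units of the sixteenth decimal.
\<close>

lemma Digamma_1_greater: "Digamma (1 :: real) > - 0.577215664901534"
proof -
  have "L 80 (3/4) < Digamma (80 + 1 :: real)"
    using L_less_Digamma_from[of "3/4" 80 80] by (simp add: skew_def power2_eq_square)
  also have "L 80 (3/4) = 8/421 * ln (77773/12) + 405/842 * ln (874841/135)"
    by (simp add: L_def power2_eq_square)
  finally show ?thesis
    using ln_fst_80_lower ln_snd_80_lower unfolding Digamma_1_eq harm_80 by simp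
qed

lemma Digamma_1_less_L_0: "Digamma 1 < L 0 0.5129670714025"
proof -
  have "L 0 0.5129670714025 = 16000000000000000000000/410914711534290847976489 * ln (1015560485683/1200000000000)
      + 378914711534290847976489/821829423068581695952978 * ln (535560485683/1846681457049)"
    by (simp add: L_def power2_eq_square)
  then show ?thesis
    using ln_fst_0_hi ln_snd_0_hi Digamma_1_less by simp
qed

lemma L_0_less_Digamma_1: "L 0 0.5129670714015 < Digamma 1"
proof -
  have "L 0 0.5129670714015 = 400000000000000000000000/10272867788320337570271281 * ln (5077802428409/6000000000000)
      + 9472867788320337570271281/20545735576640675140542562 * ln (2677802428409/9233407285227)"
    by (simp add: L_def power2_eq_square)
  then show ?thesis
    using ln_fst_0_lo ln_snd_0_lo Digamma_1_greater by simp
qed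

section \<open>The threshold\<close>

lemma gap_tendsto_at_0:
  assumes "1/15 < a"
  shows "(gap a \<longlongrightarrow> gap a 0) (at_right 0)"
proof -
  have "((\<lambda>x. Digamma (x + 1) :: real) \<longlongrightarrow> Digamma (0 + 1)) (at_right 0)"
    by (intro tendsto_intros) (auto elim: nonpos_Ints_cases)
  moreover have "((\<lambda>x. L x a) \<longlongrightarrow> L 0 a) (at_right 0)"
    using DERIV_isCont[OF L_has_real_derivative[OF assms, of 0]]
    by (simp add: isCont_def filterlim_at_split)
  ultimately show ?thesis
    unfolding gap_def[abs_def] by (intro tendsto_diff)
qed

theorem theorem5:
  shows "\<exists>a0::real.
           a0 \<in> {1/15<..} \<and> Digamma 1 - L 0 a0 = 0 \<and>
           (\<forall>b\<in>{1/15<..}. Digamma 1 - L 0 b = 0 \<longrightarrow> b = a0) \<and>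
           \<bar>a0 - 0.512967071402\<bar> < 5 / 10^13 \<and>
           (\<forall>a\<in>{1/15<..}. (\<forall>x>0. Digamma (x + 1) > L x a) \<longleftrightarrow> a \<in> {1/15<..a0})"
proof -
  define lo hi :: real where "lo = 0.5129670714015" and "hi = 0.5129670714025"
  have "\<exists>a0\<ge>lo. a0 \<le> hi \<and> L 0 a0 = Digamma 1"
  proof (rule IVT')
    show "L 0 lo \<le> Digamma 1" "Digamma 1 \<le> L 0 hi"
      using L_0_less_Digamma_1 Digamma_1_less_L_0 by (auto simp: lo_def hi_def)
    show "continuous_on {lo..hi} (L 0)"
      unfolding L_def[abs_def]
      by (intro continuous_intros) (auto simp: lo_def add_nonneg_eq_0_iff)
  qed (simp add: lo_def hi_def)
  then obtain a0 where a0: "lo \<le> a0" "a0 \<le> hi" "L 0 a0 = Digamma 1" by blast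
  then have "a0 \<noteq> lo" "a0 \<noteq> hi"
    using L_0_less_Digamma_1 Digamma_1_less_L_0 unfolding lo_def hi_def by (metis less_irrefl)+
  with a0 have strict: "lo < a0" "a0 < hi" by auto
  then have a0_gt: "1/15 < a0" by (simp add: lo_def)
  \<comment> \<open>The lower bound is for \<open>gap_0_less\<close>, the upper one for the sign change to lie below \<open>1/6\<close>.\<close>
  have skew_a0: "7/15 \<le> skew a0" "skew a0 \<le> 47/100"
  proof -
    have "7/15 \<le> skew (512/1000)" "skew (513/1000) \<le> 47/100"
      by (auto simp: skew_def)
    then show "7/15 \<le> skew a0" "skew a0 \<le> 47/100"
      using skew_strict_mono[of "512/1000" a0] skew_strict_mono[of a0 "513/1000"] strict
      by (auto simp: lo_def hi_def)
  qed

  have unique: "b = a0" if "1/15 < b" "L 0 b = Digamma 1" for b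
    using L_strict_mono[of a0 b 0] L_strict_mono[of b a0 0] that a0 a0_gt
    by (cases b a0 rule: linorder_cases) auto

  have at_a0: "L x a0 < Digamma (x + 1)" if "x > 0" for x
  proof (cases "x \<le> 1/6")
    case True
    then show ?thesis
      using gap_0_less[of a0 x] a0 a0_gt skew_a0 that by (simp add: gap_def)
  next
    case False
    \<comment> \<open>The sign change for \<open>a0\<close> is at \<open>x = 0.151...\<close>, just below \<open>1/6\<close>.\<close>
    have "(4 + 15 * skew a0)\<^sup>2 \<le> (4 + 15 * (47/100))\<^sup>2"
      using skew_a0 by (intro power_mono) auto
    also have "\<dots> < 15 * (16 - 21 * (47/100)) * (1/6 + 1)\<^sup>2"
      by (simp add: power2_eq_square)
    also have "\<dots> \<le> 15 * (16 - 21 * skew a0) * (1/6 + 1)\<^sup>2"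
      using skew_a0 by (intro mult_right_mono) auto
    finally show ?thesis
      using L_less_Digamma_from[of a0 "1/6" x] a0_gt False by simp
  qed

  have iff: "(\<forall>x>0. Digamma (x + 1) > L x a) \<longleftrightarrow> a \<le> a0" if a: "1/15 < a" for a
  proof
    assume "a \<le> a0"
    then have "L x a \<le> L x a0" if "x > 0" for x
      using L_strict_mono[of a a0 x] a that by (cases "a = a0") auto
    with at_a0 show "\<forall>x>0. Digamma (x + 1) > L x a" by force
  next
    assume less: "\<forall>x>0. Digamma (x + 1) > L x a"
    have "0 \<le> gap a 0"
    proof (rule tendsto_lowerbound[OF gap_tendsto_at_0[OF a]])
      show "\<forall>\<^sub>F x in at_right 0. 0 \<le> gap a x"
        using eventually_at_right_less[of 0]
        by eventually_elim (use less in \<open>auto simp: gap_def intro: less_imp_le\<close>)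
    qed simp
    then have "L 0 a \<le> L 0 a0" by (simp add: gap_def a0)
    then show "a \<le> a0"
      using L_strict_mono[of a0 a 0] a0_gt by force
  qed

  show ?thesis
  proof (rule exI[of _ a0], intro conjI ballI impI)
    show "a0 \<in> {1/15<..}" using a0_gt by simp
    show "Digamma 1 - L 0 a0 = 0" unfolding a0(3) by simp
    show "\<bar>a0 - 0.512967071402\<bar> < 5 / 10^13"
      using strict unfolding abs_less_iff by (simp add: lo_def hi_def)
  next
    fix b :: real
    assume "b \<in> {1/15<..}" "Digamma 1 - L 0 b = 0"
    then show "b = a0" by (intro unique) simp_all
  next
    fix a :: real
    assume "a \<in> {1/15<..}"
    then have a: "1/15 < a" by simp
    show "(\<forall>x>0. Digamma (x + 1) > L x a) \<longleftrightarrow> a \<in> {1/15<..a0}"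
      unfolding iff[OF a] using a by simp
  qed
qed

end
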